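(* Let $\varphi$ be a Finsler norm in $\mathbb{R}^d$ with $\varphi\in C^2(\mathbb{R}^d\setminus\{0\})$. Then $\varphi$ is a shielding norm for itself.
   Context: $\mathcal{S}^d$ is the space of real symmetric $d\times d$ matrices; $\langle\cdot,\cdot\rangle$ and $\|\cdot\|$ are the Euclidean inner product and norm. A Finsler norm is a function $\varphi:\mathbb{R}^d\to[0,\infty)$ with $\varphi(\lambda q)=\lambda\varphi(q)$ for $\lambda>0$, $\varphi(q_1+q_2)\le\varphi(q_1)+\varphi(q_2)$, and $\min_{q\neq0}\varphi(q)/\|q\|>0$ (symmetry is not required). The dual norm is $\varphi^*(p)=\max_{q\ne0}\langle p,q\rangle/\varphi(q)$, and $\partial\varphi^*(p)$ is the usual convex subdifferential of $\varphi^*$ at $p$. For $p\in\mathbb{R}^d$ let $\mathcal{T}(p,\varphi)=\{v\in\mathbb{R}^d:\langle v,q\rangle=0\ \text{for all}\ q\in\partial\varphi^*(p)\}$. For a linear subspace $V\subseteq\mathbb{R}^d$ let $\pi_V$ be the orthogonal projection onto $V$ and $\mathcal{S}_V=\{X\in\mathcal{S}^d:\pi_V X\pi_V=X\}$. Set $\mathcal{S}(p,\varphi)=\mathcal{S}_{\langle p\rangle\oplus\mathcal{T}(p,\varphi)}$, where $\langle p\rangle$ is the linear span of $p$. A Finsler norm $\psi$ is a shielding norm for $\varphi$ if $\psi\in C^2(\mathbb{R}^d\setminus\{0\})$ and $D^2\psi(q)\in\mathcal{S}(D\psi(q),\varphi)$ for every $q\in\mathbb{R}^d\setminus\{0\}$.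 *)

theory Defs
  imports "HOL-Analysis.Analysis"
begin

definition finsler_norm :: "(real^'d \<Rightarrow> real) \<Rightarrow> bool" where
  "finsler_norm \<phi> \<longleftrightarrow>
     (\<forall>q. 0 \<le> \<phi> q) \<and>
     (\<forall>c q. c > 0 \<longrightarrow> \<phi> (c *\<^sub>R q) = c * \<phi> q) \<and>
     (\<forall>q\<^sub>1 q\<^sub>2. \<phi> (q\<^sub>1 + q\<^sub>2) \<le> \<phi> q\<^sub>1 + \<phi> q\<^sub>2) \<and>
     (\<exists>q\<^sub>0. is_arg_min (\<lambda>q. \<phi> q / norm q) (\<lambda>q. q \<noteq> 0) q\<^sub>0 \<and> \<phi> q\<^sub>0 / norm q\<^sub>0 > 0)"

(* For a Finsler norm the supremum is attained, so it is a maximum; the lemma below supplies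
   the boundedness without which a supremum of reals is unspecified. *)
definition dual_norm :: "(real^'d \<Rightarrow> real) \<Rightarrow> real^'d \<Rightarrow> real" where
  "dual_norm \<phi> p = (SUP q\<in>-{0}. (p \<bullet> q) / \<phi> q)"

lemma bdd_above_dual_norm:
  assumes "finsler_norm \<phi>"
  shows "bdd_above ((\<lambda>q. (p \<bullet> q) / \<phi> q) ` (-{0}))"
proof -
  obtain q\<^sub>0 where min: "is_arg_min (\<lambda>q. \<phi> q / norm q) (\<lambda>q. q \<noteq> 0) q\<^sub>0"
    and pos: "\<phi> q\<^sub>0 / norm q\<^sub>0 > 0"
    using assms unfolding finsler_norm_def by blast
  define m where "m = \<phi> q\<^sub>0 / norm q\<^sub>0"
  have "(p \<bullet> q) / \<phi> q \<le> norm p / m" if "q \<noteq> 0" for q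
  proof -
    have "m \<le> \<phi> q / norm q"
      using min that unfolding is_arg_min_linorder m_def by blast
    then have le: "m * norm q \<le> \<phi> q"
      using that by (simp add: field_simps)
    have "m > 0" using pos by (simp add: m_def)
    then have mq: "m * norm q > 0" using that by simp
    have "(p \<bullet> q) / \<phi> q \<le> (norm p * norm q) / \<phi> q"
      using le mq norm_cauchy_schwarz by (intro divide_right_mono) auto
    also have "\<dots> \<le> (norm p * norm q) / (m * norm q)"
      using le mq by (intro divide_left_mono) auto
    also have "\<dots> = norm p / m" using that by simp
    finally show ?thesis .
  qed
  then show ?thesis by (intro bdd_aboveI2[where M = "norm p / m"]) auto
qed

definition subdifferential :: "(real^'d \<Rightarrow> real) \<Rightarrow> real^'d \<Rightarrow> (real^'d) set" where
  "subdifferential f p = {q. \<forall>p'. f p' \<ge> f p + q \<bullet> (p' - p)}"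

definition \<T> :: "real^'d \<Rightarrow> (real^'d \<Rightarrow> real) \<Rightarrow> (real^'d) set" where
  "\<T> p \<phi> = {v. \<forall>q \<in> subdifferential (dual_norm \<phi>) p. v \<bullet> q = 0}"

definition orth_proj :: "(real^'d) set \<Rightarrow> real^'d \<Rightarrow> real^'d" where
  "orth_proj V x = (THE y. y \<in> V \<and> (\<forall>v\<in>V. (x - y) \<bullet> v = 0))"

lemma orth_proj_ex1:
  fixes V :: "(real^'d) set"
  assumes "subspace V"
  shows "\<exists>!y. y \<in> V \<and> (\<forall>v\<in>V. (x - y) \<bullet> v = 0)"
proof (rule ex_ex1I)
  show "\<exists>y. y \<in> V \<and> (\<forall>v\<in>V. (x - y) \<bullet> v = 0)"
  proof -
    obtain y z where "y \<in> span V" "\<And>w. w \<in> span V \<Longrightarrow> orthogonal z w" "x = y + z"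
      using orthogonal_subspace_decomp_exists[of V x] by metis
    then show ?thesis
      using assms by (intro exI[of _ y]) (auto simp: orthogonal_def span_eq_iff[THEN iffD2])
  qed
next
  fix y z
  assume y: "y \<in> V \<and> (\<forall>v\<in>V. (x - y) \<bullet> v = 0)" and z: "z \<in> V \<and> (\<forall>v\<in>V. (x - z) \<bullet> v = 0)"
  then have "y - z \<in> V" using assms subspace_diff by blast
  then have "(x - z) \<bullet> (y - z) - (x - y) \<bullet> (y - z) = 0" using y z by simp
  then have "(y - z) \<bullet> (y - z) = 0" by (simp add: inner_diff_left)
  then show "y = z" by simp
qed

definition sym_on :: "(real^'d) set \<Rightarrow> (real^'d^'d) set" where
  "sym_on V = {X. transpose X = X \<and> matrix (orth_proj V) ** X ** matrix (orth_proj V) = X}"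

(* The sum is direct: for p = 0 the first summand is trivial, and for p \<noteq> 0 every q in the
   (nonempty) subdifferential satisfies p \<bullet> q = dual_norm \<phi> p > 0, so p is not in \<T> p \<phi>. *)
definition \<S> :: "real^'d \<Rightarrow> (real^'d \<Rightarrow> real) \<Rightarrow> (real^'d^'d) set" where
  "\<S> p \<phi> = sym_on {x + y |x y. x \<in> span {p} \<and> y \<in> \<T> p \<phi>}"

definition gradient :: "(real^'d \<Rightarrow> real) \<Rightarrow> real^'d \<Rightarrow> real^'d" where
  "gradient f x = (\<chi> i. frechet_derivative f (at x) (axis i 1))"

definition hessian :: "(real^'d \<Rightarrow> real) \<Rightarrow> real^'d \<Rightarrow> real^'d^'d" where
  "hessian f x = jacobian (gradient f) (at x)"

(* Meaningful for open sets only, since derivatives are taken in the whole space. *)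
definition C2_on :: "(real^'d) set \<Rightarrow> (real^'d \<Rightarrow> real) \<Rightarrow> bool" where
  "C2_on U f \<longleftrightarrow>
     (\<forall>x\<in>U. f differentiable (at x)) \<and>
     (\<forall>x\<in>U. gradient f differentiable (at x)) \<and>
     continuous_on U (hessian f)"

definition shielding_norm :: "(real^'d \<Rightarrow> real) \<Rightarrow> (real^'d \<Rightarrow> real) \<Rightarrow> bool" where
  "shielding_norm \<psi> \<phi> \<longleftrightarrow>
     finsler_norm \<psi> \<and> C2_on (-{0}) \<psi> \<and>
     (\<forall>q. q \<noteq> 0 \<longrightarrow> hessian \<psi> q \<in> \<S> (gradient \<psi> q) \<phi>)"

end

theory Submission
  imports Defs
begin

text \<open>
  Fix \<open>q \<noteq> 0\<close> and put \<open>p = D\<phi>(q)\<close>. The point is that the Hessian at \<open>q\<close> annihilates every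
  \<open>v \<in> \<partial>\<phi>\<^sup>*(p)\<close>; the Hessian being symmetric, its range is then orthogonal to \<open>\<partial>\<phi>\<^sup>*(p)\<close>, so it lies
  in \<open>\<T>(p, \<phi>)\<close> and a fortiori in the span of \<open>p\<close> and \<open>\<T>(p, \<phi>)\<close>. A symmetric matrix whose range lies in a
  subspace is unchanged by compression to that subspace, and this gives the claim.

  To see that \<open>v\<close> is annihilated, note first that \<open>\<phi>\<^sup>*(D\<phi>(x)) = 1\<close> for every \<open>x \<noteq> 0\<close>, because
  \<open>\<langle>D\<phi>(x), r\<rangle> \<le> \<phi>(r)\<close> for all \<open>r\<close>, with equality at \<open>r = x\<close> by Euler's identity
  (\<open>dual_norm_gradient\<close>). If \<open>v \<noteq> 0\<close>, the subgradient inequality of \<open>\<phi>\<^sup>*\<close> between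
  the two points \<open>p\<close> and \<open>D\<phi>(v)\<close>, where \<open>\<phi>\<^sup>*\<close> takes the same value, reads
  \<open>\<langle>v, D\<phi>(v)\<rangle> \<le> \<langle>v, p\<rangle>\<close>. Hence \<open>\<phi>(v) \<le> \<langle>p, v\<rangle>\<close>, and equality holds
  (\<open>gradient_supports_dual_subdifferential\<close>). So \<open>\<phi>\<close> coincides with the linear functional \<open>p\<close>, which
  it dominates everywhere, at both \<open>q\<close> and \<open>v\<close>, and by subadditivity on the whole ray
  \<open>q + t v\<close>, \<open>t \<ge> 0\<close>. At each point of contact the difference \<open>\<phi> - p\<close> is minimal, so
  \<open>D\<phi> = p\<close> along the ray (\<open>gradient_constant_along_ray\<close>), and differentiating at
  \<open>t = 0\<close> gives \<open>D\<^sup>2\<phi>(q) v = 0\<close>.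
\<close>

section \<open>Symmetry of the second derivative\<close>

lemma derivative_along_line:
  fixes f :: "'a::real_inner \<Rightarrow> real"
  assumes "(f has_derivative (\<lambda>h. p \<bullet> h)) (at (a + t *\<^sub>R r))"
  shows "((\<lambda>t. f (a + t *\<^sub>R r)) has_real_derivative p \<bullet> r) (at t)"
proof -
  have "((\<lambda>t. a + t *\<^sub>R r) has_derivative (\<lambda>h. h *\<^sub>R r)) (at t)"
    by (auto intro!: derivative_eq_intros)
  from has_derivative_compose[OF this assms]
  show ?thesis by (simp add: has_field_derivative_def mult_commute_abs)
qed

text \<open>
  The mixed second difference of \<open>f\<close> is symmetric in \<open>u\<close> and \<open>v\<close>, whereas its leading term is written
  as an asymmetric expression in them; comparing the two forms yields the symmetry of the second
  derivative. Differentiability of the gradient at the single point \<open>x\<close> suffices: the mean value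
  theorem in the direction \<open>u\<close> leaves a difference of two gradients near \<open>x\<close>, each of which is
  linearised at \<open>x\<close>.
\<close>
lemma second_difference_estimate:
  fixes f :: "'a::real_inner \<Rightarrow> real" and g :: "'a \<Rightarrow> 'a"
  assumes "open U" "x \<in> U"
    and f: "\<And>y. y \<in> U \<Longrightarrow> (f has_derivative (\<lambda>h. g y \<bullet> h)) (at y)"
    and g: "(g has_derivative G) (at x)"
    and "e > 0"
  shows "\<exists>d>0. \<forall>s. 0 < s \<and> s < d \<longrightarrow>
    \<bar>f (x + s *\<^sub>R u + s *\<^sub>R v) - f (x + s *\<^sub>R u) - f (x + s *\<^sub>R v) + f x - s\<^sup>2 * (G v \<bullet> u)\<bar> \<le> e * s\<^sup>2"
proof -
  \<comment> \<open>\<open>K\<close> bounds \<open>norm u + norm v\<close>; the summand 1 keeps it positive when \<open>u = v = 0\<close>. The final error is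
    \<open>2 e' K\<^sup>2 s\<^sup>2\<close>: one factor \<open>K\<close> from the size of the increments, one from pairing with \<open>u\<close>, and the
    factor 2 from linearising two gradients.\<close>
  define K where "K = norm u + norm v + 1"
  have K: "K > 0" "norm u \<le> K" by (auto simp: K_def add_nonneg_pos)
  define e' where "e' = e / (2 * K\<^sup>2)"
  have e': "e' > 0" using \<open>e > 0\<close> K by (simp add: e'_def)
  obtain r where r: "r > 0" "ball x r \<subseteq> U"
    using \<open>open U\<close> \<open>x \<in> U\<close> open_contains_ball by blast
  obtain d1 where d1: "d1 > 0"
    "\<And>y. norm (y - x) < d1 \<Longrightarrow> norm (g y - g x - G (y - x)) \<le> e' * norm (y - x)"
    using g e' unfolding has_derivative_at_alt by blast
  interpret G: bounded_linear G using g by (rule has_derivative_bounded_linear)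
  define d where "d = min d1 r / K"
  have "d > 0" using d1 r K by (simp add: d_def)
  have est: "\<bar>f (x + s *\<^sub>R u + s *\<^sub>R v) - f (x + s *\<^sub>R u) - f (x + s *\<^sub>R v) + f x - s\<^sup>2 * (G v \<bullet> u)\<bar> \<le> e * s\<^sup>2"
    if s: "0 < s" "s < d" for s
  proof -
    have sK: "s * K < d1" "s * K < r" using s K by (auto simp: d_def pos_less_divide_eq)
    have small: "norm (t *\<^sub>R u + c *\<^sub>R v) \<le> s * K" if "0 \<le> t" "t \<le> s" "0 \<le> c" "c \<le> s" for t c
    proof -
      have "norm (t *\<^sub>R u + c *\<^sub>R v) \<le> t * norm u + c * norm v"
        using norm_triangle_ineq[of "t *\<^sub>R u" "c *\<^sub>R v"] that by simp
      also have "\<dots> \<le> s * norm u + s * norm v"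
        using that by (intro add_mono mult_right_mono) auto
      also have "\<dots> \<le> s * K" using s by (simp add: K_def distrib_left)
      finally show ?thesis .
    qed
    have inU: "x + t *\<^sub>R u + c *\<^sub>R v \<in> U" if "0 \<le> t" "t \<le> s" "0 \<le> c" "c \<le> s" for t c
    proof (rule subsetD[OF r(2)])
      have "dist (x + t *\<^sub>R u + c *\<^sub>R v) x = norm (t *\<^sub>R u + c *\<^sub>R v)"
        by (simp add: dist_norm add.assoc)
      then show "x + t *\<^sub>R u + c *\<^sub>R v \<in> ball x r"
        using small[OF that] sK by (simp add: dist_commute)
    qed
    have f_line: "((\<lambda>t. f (x + t *\<^sub>R u + c *\<^sub>R v)) has_real_derivative g (x + t *\<^sub>R u + c *\<^sub>R v) \<bullet> u) (at t)"
      if "0 \<le> t" "t \<le> s" "0 \<le> c" "c \<le> s" for t c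
      using derivative_along_line[of f "g (x + t *\<^sub>R u + c *\<^sub>R v)" "x + c *\<^sub>R v" t u] f[OF inU[OF that]]
      by (simp add: ac_simps)
    \<comment> \<open>The null terms \<open>0 *\<^sub>R u\<close> and \<open>0 *\<^sub>R v\<close> bring all four corners into the form covered by
      \<open>f_line\<close>.\<close>
    have "\<exists>z>0. z < s \<and> (f (x + s *\<^sub>R u + s *\<^sub>R v) - f (x + s *\<^sub>R u + 0 *\<^sub>R v))
        - (f (x + 0 *\<^sub>R u + s *\<^sub>R v) - f (x + 0 *\<^sub>R u + 0 *\<^sub>R v))
        = (s - 0) * (g (x + z *\<^sub>R u + s *\<^sub>R v) \<bullet> u - g (x + z *\<^sub>R u + 0 *\<^sub>R v) \<bullet> u)"
    proof (rule MVT2[OF s(1), where f = "\<lambda>t. f (x + t *\<^sub>R u + s *\<^sub>R v) - f (x + t *\<^sub>R u + 0 *\<^sub>R v)"])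
      show "((\<lambda>t. f (x + t *\<^sub>R u + s *\<^sub>R v) - f (x + t *\<^sub>R u + 0 *\<^sub>R v)) has_real_derivative
          g (x + z *\<^sub>R u + s *\<^sub>R v) \<bullet> u - g (x + z *\<^sub>R u + 0 *\<^sub>R v) \<bullet> u) (at z)"
        if "0 \<le> z" "z \<le> s" for z
        by (intro DERIV_diff f_line) (use that s in linarith)+
    qed
    then obtain z where z: "0 < z" "z < s" and
      mvt: "f (x + s *\<^sub>R u + s *\<^sub>R v) - f (x + s *\<^sub>R u) - f (x + s *\<^sub>R v) + f x
          = s * ((g (x + z *\<^sub>R u + s *\<^sub>R v) - g (x + z *\<^sub>R u)) \<bullet> u)"
      by (auto simp: inner_diff_left algebra_simps)
    have lin: "norm (g (x + z *\<^sub>R u + c *\<^sub>R v) - g x - G (z *\<^sub>R u + c *\<^sub>R v)) \<le> e' * (s * K)"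
      if "0 \<le> c" "c \<le> s" for c
    proof -
      have n: "norm (z *\<^sub>R u + c *\<^sub>R v) \<le> s * K" using small z that by simp
      then have "norm (g (x + z *\<^sub>R u + c *\<^sub>R v) - g x - G (z *\<^sub>R u + c *\<^sub>R v)) \<le> e' * norm (z *\<^sub>R u + c *\<^sub>R v)"
        using d1(2)[of "x + z *\<^sub>R u + c *\<^sub>R v"] sK by (simp add: add.assoc)
      also have "\<dots> \<le> e' * (s * K)" using n e' by simp
      finally show ?thesis .
    qed
    define w where "w = g (x + z *\<^sub>R u + s *\<^sub>R v) - g (x + z *\<^sub>R u) - s *\<^sub>R G v"
    have w_eq: "w = (g (x + z *\<^sub>R u + s *\<^sub>R v) - g x - G (z *\<^sub>R u + s *\<^sub>R v))
            - (g (x + z *\<^sub>R u + 0 *\<^sub>R v) - g x - G (z *\<^sub>R u + 0 *\<^sub>R v))"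
      by (simp add: w_def G.add G.scaleR)
    have "norm w \<le> e' * (s * K) + e' * (s * K)"
      unfolding w_eq by (rule norm_triangle_le_diff, rule add_mono; rule lin) (use s in auto)
    then have "norm w * norm u \<le> (2 * e' * (s * K)) * K"
      using K e' s by (intro mult_mono) (auto simp: ac_simps)
    then have "\<bar>w \<bullet> u\<bar> \<le> (2 * e' * (s * K)) * K"
      using Cauchy_Schwarz_ineq2[of w u] by linarith
    then have "s * \<bar>w \<bullet> u\<bar> \<le> s * ((2 * e' * (s * K)) * K)"
      using s by simp
    also have "\<dots> = e * s\<^sup>2" using K by (simp add: e'_def power2_eq_square)
    finally have "\<bar>s * (w \<bullet> u)\<bar> \<le> e * s\<^sup>2" using s by (simp add: abs_mult)
    moreover have "s * (w \<bullet> u) = f (x + s *\<^sub>R u + s *\<^sub>R v) - f (x + s *\<^sub>R u) - f (x + s *\<^sub>R v) + f x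
        - s\<^sup>2 * (G v \<bullet> u)"
      unfolding mvt w_def by (simp add: inner_diff_left algebra_simps power2_eq_square)
    ultimately show ?thesis by simp
  qed
  then show ?thesis using \<open>d > 0\<close> by blast
qed

lemma derivative_of_gradient_symmetric:
  fixes f :: "'a::real_inner \<Rightarrow> real" and g :: "'a \<Rightarrow> 'a"
  assumes "open U" "x \<in> U"
    and "\<And>y. y \<in> U \<Longrightarrow> (f has_derivative (\<lambda>h. g y \<bullet> h)) (at y)"
    and "(g has_derivative G) (at x)"
  shows "G v \<bullet> u = G u \<bullet> v"
proof -
  have "\<bar>G v \<bullet> u - G u \<bullet> v\<bar> \<le> e" if "e > 0" for e
  proof -
    have "e / 2 > 0" using that by simp
    note est = second_difference_estimate[OF assms this]
    obtain d1 where d1: "d1 > 0" "\<And>s. 0 < s \<and> s < d1 \<Longrightarrow>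
      \<bar>f (x + s *\<^sub>R u + s *\<^sub>R v) - f (x + s *\<^sub>R u) - f (x + s *\<^sub>R v) + f x - s\<^sup>2 * (G v \<bullet> u)\<bar> \<le> e / 2 * s\<^sup>2"
      using est[of u v] by blast
    obtain d2 where d2: "d2 > 0" "\<And>s. 0 < s \<and> s < d2 \<Longrightarrow>
      \<bar>f (x + s *\<^sub>R v + s *\<^sub>R u) - f (x + s *\<^sub>R v) - f (x + s *\<^sub>R u) + f x - s\<^sup>2 * (G u \<bullet> v)\<bar> \<le> e / 2 * s\<^sup>2"
      using est[of v u] by blast
    define s where "s = min d1 d2 / 2"
    have s: "0 < s" "s < d1" "s < d2" using d1(1) d2(1) by (auto simp: s_def min_def)
    have comm: "x + s *\<^sub>R v + s *\<^sub>R u = x + s *\<^sub>R u + s *\<^sub>R v" by simp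
    have "\<bar>s\<^sup>2 * (G v \<bullet> u) - s\<^sup>2 * (G u \<bullet> v)\<bar> \<le> e * s\<^sup>2"
      using d1(2)[of s] d2(2)[of s] s unfolding comm by argo
    moreover have "s\<^sup>2 * (G v \<bullet> u) - s\<^sup>2 * (G u \<bullet> v) = s\<^sup>2 * (G v \<bullet> u - G u \<bullet> v)"
      by (simp only: right_diff_distrib)
    ultimately have "s\<^sup>2 * \<bar>G v \<bullet> u - G u \<bullet> v\<bar> \<le> s\<^sup>2 * e"
      by (simp only: abs_mult abs_power2 mult.commute[of e])
    then show ?thesis using s by simp
  qed
  then have "\<bar>G v \<bullet> u - G u \<bullet> v\<bar> \<le> 0" by (rule field_le_epsilon) simp
  then show ?thesis by simp
qed

lemma has_derivative_gradient:
  assumes "f differentiable (at x)"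
  shows "(f has_derivative (\<lambda>h. gradient f x \<bullet> h)) (at x)"
proof -
  have f': "(f has_derivative frechet_derivative f (at x)) (at x)"
    using assms frechet_derivative_works by blast
  then interpret f': linear "frechet_derivative f (at x)"
    by (rule has_derivative_linear)
  have "frechet_derivative f (at x) h = gradient f x \<bullet> h" for h
  proof -
    have "frechet_derivative f (at x) h = frechet_derivative f (at x) (\<Sum>i\<in>UNIV. h $ i *\<^sub>R axis i 1)"
      using basis_expansion[of h] by (simp add: scalar_mult_eq_scaleR)
    also have "\<dots> = gradient f x \<bullet> h"
      by (simp add: f'.sum f'.scale gradient_def inner_vec_def mult.commute)
    finally show ?thesis .
  qed
  then have "frechet_derivative f (at x) = (\<lambda>h. gradient f x \<bullet> h)" by blast
  then show ?thesis using f' by simp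
qed

lemma C2_on_has_derivative:
  assumes "C2_on U f" "x \<in> U"
  shows "(f has_derivative (\<lambda>h. gradient f x \<bullet> h)) (at x)"
    and "(gradient f has_derivative (\<lambda>h. hessian f x *v h)) (at x)"
  using assms has_derivative_gradient jacobian_works[of "gradient f" "at x"]
  unfolding C2_on_def hessian_def by auto

lemma hessian_inner_symmetric:
  assumes "open U" "C2_on U f" "x \<in> U"
  shows "(hessian f x *v v) \<bullet> u = (hessian f x *v u) \<bullet> v"
  using derivative_of_gradient_symmetric[OF assms(1,3) C2_on_has_derivative(1)[OF assms(2)]
      C2_on_has_derivative(2)[OF assms(2,3)]]
  by blast

section \<open>Gradients of a Finsler norm\<close>

lemma finsler_norm_pos:
  assumes "finsler_norm \<phi>" "q \<noteq> 0"
  shows "\<phi> q > 0"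
proof -
  obtain q0 where "is_arg_min (\<lambda>q. \<phi> q / norm q) (\<lambda>q. q \<noteq> 0) q0" "\<phi> q0 / norm q0 > 0"
    using assms unfolding finsler_norm_def by blast
  then have "\<phi> q / norm q > 0"
    using assms(2) unfolding is_arg_min_linorder by (meson less_le_trans)
  then show ?thesis using assms(2) by (simp add: zero_less_divide_iff)
qed

lemma finsler_norm_scale:
  assumes "finsler_norm \<phi>" "c > 0"
  shows "\<phi> (c *\<^sub>R q) = c * \<phi> q"
  using assms unfolding finsler_norm_def by blast

lemma finsler_norm_add_scale_le:
  assumes "finsler_norm \<phi>" "t > 0"
  shows "\<phi> (q + t *\<^sub>R r) \<le> \<phi> q + t * \<phi> r"
  using assms finsler_norm_scale[OF assms] unfolding finsler_norm_def by metis

lemma finsler_gradient_Euler: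
  assumes "finsler_norm \<phi>" "\<phi> differentiable (at q)"
  shows "gradient \<phi> q \<bullet> q = \<phi> q"
proof -
  have "((\<lambda>t. \<phi> (0 + t *\<^sub>R q)) has_real_derivative gradient \<phi> q \<bullet> q) (at 1)"
    by (rule derivative_along_line) (use has_derivative_gradient[OF assms(2)] in simp)
  moreover have "((\<lambda>t. \<phi> (0 + t *\<^sub>R q)) has_real_derivative \<phi> q) (at 1)"
  proof (rule has_field_derivative_transform_within_open[of "\<lambda>t. t * \<phi> q" _ _ "{0<..}"])
    show "((\<lambda>t. t * \<phi> q) has_real_derivative \<phi> q) (at 1)"
      by (auto intro!: derivative_eq_intros)
  qed (use finsler_norm_scale[OF assms(1)] in auto)
  ultimately show ?thesis by (rule DERIV_unique)
qed

text \<open>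
  The one-sided difference quotients of \<open>\<phi>\<close> at \<open>q\<close> in the direction \<open>r\<close> are at most \<open>\<phi> r\<close> by
  subadditivity. Otherwise the function \<open>t \<mapsto> t \<phi>(r) - \<phi>(q + t r)\<close> would decrease to the right of 0.
\<close>
lemma finsler_gradient_le:
  assumes "finsler_norm \<phi>" "\<phi> differentiable (at q)"
  shows "gradient \<phi> q \<bullet> r \<le> \<phi> r"
proof (rule ccontr)
  assume "\<not> gradient \<phi> q \<bullet> r \<le> \<phi> r"
  then have neg: "\<phi> r - gradient \<phi> q \<bullet> r < 0" by simp
  have "((\<lambda>t. \<phi> (q + t *\<^sub>R r)) has_real_derivative gradient \<phi> q \<bullet> r) (at 0)"
    by (rule derivative_along_line) (use has_derivative_gradient[OF assms(2)] in simp)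
  then have "((\<lambda>t. t * \<phi> r - \<phi> (q + t *\<^sub>R r)) has_real_derivative \<phi> r - gradient \<phi> q \<bullet> r) (at 0)"
    by (auto intro!: derivative_eq_intros)
  from DERIV_neg_dec_right[OF this neg]
  obtain d where d: "d > 0" "\<And>h. h > 0 \<Longrightarrow> h < d \<Longrightarrow> h * \<phi> r - \<phi> (q + h *\<^sub>R r) < - \<phi> q"
    by auto
  then show False
    using d(2)[of "d / 2"] finsler_norm_add_scale_le[OF assms(1), of "d / 2" q r] by simp
qed

lemma gradient_eq_of_supporting_functional:
  fixes f :: "real^'d \<Rightarrow> real"
  assumes "f differentiable (at x)" and "\<And>r. p \<bullet> r \<le> f r" and "f x = p \<bullet> x"
  shows "gradient f x = p"
proof -
  have "((\<lambda>y. f y - p \<bullet> y) has_derivative (\<lambda>h. gradient f x \<bullet> h - p \<bullet> h)) (at x)"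
    by (intro derivative_intros has_derivative_gradient assms(1))
  then have "(\<lambda>h. gradient f x \<bullet> h - p \<bullet> h) = (\<lambda>h. 0)"
    by (rule has_derivative_local_min) (use assms in auto)
  then have "(gradient f x - p) \<bullet> h = 0" for h
    by (metis inner_diff_left)
  then show ?thesis by (metis inner_eq_zero_iff right_minus_eq)
qed

lemma dual_norm_gradient:
  assumes "finsler_norm \<phi>" "\<phi> differentiable (at q)" "q \<noteq> 0"
  shows "dual_norm \<phi> (gradient \<phi> q) = 1"
  unfolding dual_norm_def
proof (rule cSup_eq_maximum)
  show "1 \<in> (\<lambda>r. gradient \<phi> q \<bullet> r / \<phi> r) ` (- {0})"
    using finsler_gradient_Euler[OF assms(1,2)] finsler_norm_pos[OF assms(1,3)] assms(3)
    by (intro image_eqI[of _ _ q]) auto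
  show "y \<le> 1" if y: "y \<in> (\<lambda>r. gradient \<phi> q \<bullet> r / \<phi> r) ` (- {0})" for y
  proof -
    obtain r where "r \<noteq> 0" "y = gradient \<phi> q \<bullet> r / \<phi> r" using y by auto
    then show ?thesis
      using finsler_gradient_le[OF assms(1,2), of r] finsler_norm_pos[OF assms(1), of r] by simp
  qed
qed

text \<open>
  This replaces the biduality \<open>\<phi>\<^sup>*\<^sup>* = \<phi>\<close>: testing the subgradient inequality at the gradient of \<open>\<phi>\<close> at
  \<open>v\<close> itself is enough, since the dual norm is 1 at every gradient.
\<close>
lemma gradient_supports_dual_subdifferential:
  assumes "finsler_norm \<phi>" "\<And>x. x \<noteq> 0 \<Longrightarrow> \<phi> differentiable (at x)" "q \<noteq> 0"
    and "v \<in> subdifferential (dual_norm \<phi>) (gradient \<phi> q)" "v \<noteq> 0"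
  shows "\<phi> v = gradient \<phi> q \<bullet> v"
proof (rule antisym)
  have "dual_norm \<phi> (gradient \<phi> v) \<ge> dual_norm \<phi> (gradient \<phi> q) + v \<bullet> (gradient \<phi> v - gradient \<phi> q)"
    using assms(4) unfolding subdifferential_def by blast
  then have "v \<bullet> gradient \<phi> v \<le> v \<bullet> gradient \<phi> q"
    using dual_norm_gradient[OF assms(1) assms(2)] assms(3,5) by (simp add: inner_diff_right)
  then show "\<phi> v \<le> gradient \<phi> q \<bullet> v"
    using finsler_gradient_Euler[OF assms(1) assms(2)] assms(5) by (simp add: inner_commute)
  show "gradient \<phi> q \<bullet> v \<le> \<phi> v"
    using finsler_gradient_le assms(1-3) by blast
qed

text \<open>
  By subadditivity on one side and \<open>finsler_gradient_le\<close> on the other, \<open>\<phi>\<close> agrees with its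
  linear part at \<open>q\<close> on the whole ray, so this linear functional supports \<open>\<phi>\<close> at every point of the
  ray. The ray avoids the origin because \<open>\<phi>\<close> stays positive on it.
\<close>
lemma gradient_constant_along_ray:
  assumes "finsler_norm \<phi>" "\<And>x. x \<noteq> 0 \<Longrightarrow> \<phi> differentiable (at x)" "q \<noteq> 0"
    and "\<phi> v = gradient \<phi> q \<bullet> v" "t > 0"
  shows "gradient \<phi> (q + t *\<^sub>R v) = gradient \<phi> q"
proof -
  have diff: "\<phi> differentiable (at q)" using assms(2,3) by blast
  have lin: "gradient \<phi> q \<bullet> (q + t *\<^sub>R v) = \<phi> q + t * \<phi> v"
    using finsler_gradient_Euler[OF assms(1) diff] assms(4) by (simp add: inner_add_right)
  have "\<phi> v \<ge> 0" using assms(1) unfolding finsler_norm_def by blast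
  then have "\<phi> q + t * \<phi> v > 0"
    using finsler_norm_pos[OF assms(1,3)] \<open>t > 0\<close> by (simp add: add_pos_nonneg)
  then have "q + t *\<^sub>R v \<noteq> 0" using lin by force
  moreover have "\<phi> (q + t *\<^sub>R v) = gradient \<phi> q \<bullet> (q + t *\<^sub>R v)"
    using finsler_norm_add_scale_le[OF assms(1,5)] finsler_gradient_le[OF assms(1) diff] lin
    by (metis antisym)
  ultimately show ?thesis
    using gradient_eq_of_supporting_functional finsler_gradient_le[OF assms(1) diff] assms(2)
    by blast
qed

text \<open>
  Constancy is available on a half-line only, so the derivative is taken from the right, within the
  closed half-line, where one-sided derivatives are still unique.
\<close>
lemma derivative_zero_along_constant_ray:
  fixes f :: "'a::real_normed_vector \<Rightarrow> 'b::real_normed_vector"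
  assumes "(f has_derivative D) (at x)" and "\<And>t. t > 0 \<Longrightarrow> f (x + t *\<^sub>R v) = f x"
  shows "D v = 0"
proof -
  have "((\<lambda>t. x + t *\<^sub>R v) has_derivative (\<lambda>h. h *\<^sub>R v)) (at 0 within {0..})"
    by (auto intro!: derivative_eq_intros)
  moreover have "(f has_derivative D) (at (x + 0 *\<^sub>R v))" using assms(1) by simp
  ultimately have "((\<lambda>t. f (x + t *\<^sub>R v)) has_derivative (\<lambda>h. D (h *\<^sub>R v))) (at 0 within {0..})"
    by (rule has_derivative_compose)
  then have "((\<lambda>t. f x) has_derivative (\<lambda>h. D (h *\<^sub>R v))) (at 0 within {0..})"
  proof (rule has_derivative_transform[rotated 2])
    show "f x = f (x + t *\<^sub>R v)" if "t \<in> {0..}" for t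
      using that assms(2)[of t] by (cases "t = 0") auto
  qed simp
  moreover have "((\<lambda>t::real. f x) has_derivative (\<lambda>h. 0)) (at 0 within {0..})" by simp
  ultimately have "((\<lambda>t::real. f x) has_vector_derivative D v) (at 0 within {0..})"
    "((\<lambda>t::real. f x) has_vector_derivative 0) (at 0 within {0..})"
    using linear_scale[OF has_derivative_linear[OF assms(1)]]
    by (auto simp: has_vector_derivative_def)
  moreover have "at (0::real) within {0..} \<noteq> bot"
    by (simp add: at_within_Ici_at_right)
  ultimately show ?thesis by (metis vector_derivative_within)
qed

lemma hessian_image_subset_\<T>:
  assumes "finsler_norm \<phi>" "C2_on (-{0}) \<phi>" "q \<noteq> 0"
  shows "hessian \<phi> q *v x \<in> \<T> (gradient \<phi> q) \<phi>"
proof -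
  have diff: "\<phi> differentiable (at y)" if "y \<noteq> 0" for y
    using assms(2) that unfolding C2_on_def by blast
  have "(hessian \<phi> q *v x) \<bullet> v = 0"
    if v: "v \<in> subdifferential (dual_norm \<phi>) (gradient \<phi> q)" for v
  proof -
    have "hessian \<phi> q *v v = 0"
    proof (cases "v = 0")
      case False
      have "(gradient \<phi> has_derivative (\<lambda>h. hessian \<phi> q *v h)) (at q)"
        using C2_on_has_derivative(2)[OF assms(2)] assms(3) by blast
      then show ?thesis
        by (rule derivative_zero_along_constant_ray[where D = "\<lambda>h. hessian \<phi> q *v h"])
          (use gradient_constant_along_ray[OF assms(1) diff assms(3)]
             gradient_supports_dual_subdifferential[OF assms(1) diff assms(3) v False] in blast)
    qed simp
    then show ?thesis
      using hessian_inner_symmetric[OF _ assms(2), of q x v] assms(3) by (simp add: open_Compl)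
  qed
  then show ?thesis by (simp add: \<T>_def)
qed

section \<open>Symmetric matrices supported on a subspace\<close>

lemma orth_proj_properties:
  assumes "subspace V"
  shows "orth_proj V x \<in> V" and "v \<in> V \<Longrightarrow> (x - orth_proj V x) \<bullet> v = 0"
  using theI'[OF orth_proj_ex1[OF assms, of x]] unfolding orth_proj_def by auto

lemma orth_proj_unique:
  assumes "subspace V" "y \<in> V" "\<And>v. v \<in> V \<Longrightarrow> (x - y) \<bullet> v = 0"
  shows "orth_proj V x = y"
  using orth_proj_ex1[OF assms(1), of x] orth_proj_properties[OF assms(1), where x = x] assms(2,3)
  by blast

lemma linear_orth_proj:
  assumes "subspace V"
  shows "linear (orth_proj V)"
proof (rule linearI)
  note P = orth_proj_properties[OF assms]
  show "orth_proj V (x + y) = orth_proj V x + orth_proj V y" for x y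
  proof (rule orth_proj_unique[OF assms])
    show "(x + y - (orth_proj V x + orth_proj V y)) \<bullet> v = 0" if "v \<in> V" for v
      using P(2)[OF that, of x] P(2)[OF that, of y] by (simp add: inner_diff_left inner_add_left)
  qed (use P(1) subspace_add[OF assms] in blast)
  show "orth_proj V (c *\<^sub>R x) = c *\<^sub>R orth_proj V x" for c x
  proof (rule orth_proj_unique[OF assms])
    show "(c *\<^sub>R x - c *\<^sub>R orth_proj V x) \<bullet> v = 0" if "v \<in> V" for v
      using P(2)[OF that, of x] by (simp flip: scaleR_diff_right)
  qed (use P(1) subspace_scale[OF assms] in blast)
qed

text \<open>
  Projecting after \<open>X\<close> changes nothing because the range lies in \<open>V\<close>; projecting before \<open>X\<close> changes
  nothing because the kernel of a symmetric matrix is the orthogonal complement of its range, and so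
  contains the orthogonal complement of \<open>V\<close>.
\<close>
lemma sym_onI:
  fixes X :: "real^'d^'d"
  assumes V: "subspace V" and sym: "\<And>u v. (X *v v) \<bullet> u = (X *v u) \<bullet> v"
    and range: "\<And>x. X *v x \<in> V"
  shows "X \<in> sym_on V"
proof -
  have P: "matrix (orth_proj V) *v x = orth_proj V x" for x
    by (rule matrix_works[OF linear_matrix_vector_mul_eq[THEN iffD2, OF linear_orth_proj[OF V]]])
  have PX: "orth_proj V (X *v x) = X *v x" for x
    by (rule orth_proj_unique[OF V range]) simp
  have XP: "X *v orth_proj V x = X *v x" for x
  proof -
    have "(X *v (x - orth_proj V x)) \<bullet> y = 0" for y
      using sym[of "x - orth_proj V x" y] orth_proj_properties(2)[OF V range]
      by (simp add: inner_commute)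
    then have "X *v (x - orth_proj V x) = 0" by (metis inner_eq_zero_iff)
    then show ?thesis by (simp add: matrix_vector_mult_diff_distrib)
  qed
  have "(transpose X *v x) \<bullet> y = (X *v x) \<bullet> y" for x y
    using dot_lmul_matrix[of x X y] sym[of x y] by (simp add: inner_commute)
  then have "transpose X *v x = X *v x" for x by (metis vector_eq_rdot)
  moreover have "(matrix (orth_proj V) ** X ** matrix (orth_proj V)) *v x = X *v x" for x
    by (simp add: P PX XP flip: matrix_vector_mul_assoc)
  ultimately show ?thesis unfolding sym_on_def by (simp add: matrix_eq)
qed

lemma subspace_\<T>: "subspace (\<T> p \<phi>)"
  by (auto simp: \<T>_def subspace_def inner_add_left)

theorem theorem3:
  fixes \<phi> :: "real^'d \<Rightarrow> real"
  assumes "finsler_norm \<phi>" and "C2_on (-{0}) \<phi>"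
  shows "shielding_norm \<phi> \<phi>"
proof -
  have "hessian \<phi> q \<in> \<S> (gradient \<phi> q) \<phi>" if "q \<noteq> 0" for q
    unfolding \<S>_def
  proof (rule sym_onI)
    show "subspace {x + y |x y. x \<in> span {gradient \<phi> q} \<and> y \<in> \<T> (gradient \<phi> q) \<phi>}"
      by (intro subspace_sums subspace_span subspace_\<T>)
    show "(hessian \<phi> q *v v) \<bullet> u = (hessian \<phi> q *v u) \<bullet> v" for u v
      using hessian_inner_symmetric[OF _ assms(2)] that by blast
    show "hessian \<phi> q *v x \<in> {x + y |x y. x \<in> span {gradient \<phi> q} \<and> y \<in> \<T> (gradient \<phi> q) \<phi>}" for x
      using hessian_image_subset_\<T>[OF assms that, of x] span_zero add_0 by force
  qed
  then show ?thesis using assms unfolding shielding_norm_def by blast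
qed

end
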